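(* Let $S$ be a cancellative and right amenable monoid, $G=S^{-1}S$ its group of left fractions, $X$ a discrete Abelian group and $\lambda$ a left $S$-action on $X$. Let $\bar X=X/\mathrm{Ker}(\lambda)$ with induced left $S$-action $\bar\lambda$, let $X^*=\varinjlim_{(G,\le_S)}X_g$ be the direct limit of the direct system with $X_g=\bar X$ ($g\in G$) and transition maps $\bar\lambda_s\colon X_{gs}\to X_g$ ($g\in G$, $s\in S$), and let $\varepsilon_g=\varepsilon_g^X\colon\bar X=X_g\to X^*$ be the canonical maps. Then: (1) $\varepsilon_g$ is injective for all $g\in G$; in particular, identifying $X_g$ with the image of $\varepsilon_g$, we have $X^*=\bigcup_{g\in G}X_g$; (2) there is a unique left $G$-action $\lambda^*$ on $X^*$ such that $\lambda^*_g\circ\varepsilon_h=\varepsilon_{gh}$ for all $g,h\in G$; (3) $\varepsilon_1\colon\bar X\to X^*$ is $S$-equivariant when $S$ acts on $\bar X$ via $\bar\lambda$ and on $X^*$ via the restriction of $\lambda^*$ to $S$; (4) given a second left $S$-action $\lambda'$ on an Abelian group $X'$ and an $S$-equivariant homomorphism $\phi\colon X\to X'$, there is a unique homomorphism $\phi^*\colon X^*\to(X')^*$ such that $\phi^*\circ\varepsilon^X_g=\varepsilon^{X'}_g\circ\bar\phi$ for every $g\in G$. Furthermore, $\phi^*$ is $G$-equivariant and if $\phi$ is injective (resp., surjective) then so is $\phi^*$.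
   Context: A cancellative monoid $S$ is right amenable if it admits a right F{\o}lner net, i.e. a net $\{F_i\}_{i\in I}$ of non-empty finite subsets of $S$ such that $\lim_{i\in I}|F_is\setminus F_i|/|F_i|=0$ for every $s\in S$. Such an $S$ satisfies the left Ore condition ($Ss\cap St\ne\emptyset$ for all $s,t\in S$) and so embeds in its group of left fractions $G=S^{-1}S$, in which every element has the form $s^{-1}t$ with $s,t\in S$. Preorder $G$ by $g_1\le_S g_2$ iff $g_2^{-1}g_1\in S$; this is directed. A left $S$-action $\lambda$ on an Abelian group $X$ is a family of endomorphisms $\lambda_s$ with $\lambda_1=\mathrm{id}_X$, $\lambda_{st}=\lambda_s\circ\lambda_t$ (similarly for $G$). A homomorphism $\phi\colon X\to X'$ is $S$-equivariant if $\phi\circ\lambda_s=\lambda'_s\circ\phi$ for all $s\in S$. $\mathrm{Ker}(\lambda)=\bigcup_{s\in S}\mathrm{Ker}(\lambda_s)$ is an $S$-invariant subgroup of $X$, $\pi_X\colon X\to\bar X$ is the projection, and $\bar\lambda_s(\pi_X(x))=\pi_X(\lambda_s(x))$. For an $S$-equivariant homomorphism $\phi\colon X\to X'$, $\bar\phi\colon\bar X\to\bar X'$ is the unique homomorphism with $\pi_{X'}\circ\phi=\bar\phi\circ\pi_X$. The group $(X')^*$ and the maps $\varepsilon_g^{X'}$ are constructed from $\lambda'$ as $X^*$ and $\varepsilon_g^X$ are from $\lambda$. *)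

theory Defs
  imports "HOL-Algebra.Divisibility" Complex_Main
begin

section \<open>Directed sets and right amenable monoids\<close>

definition directed_preorder_on :: "'i set \<Rightarrow> ('i \<times> 'i) set \<Rightarrow> bool" where
  "directed_preorder_on I r \<longleftrightarrow>
     I \<noteq> {} \<and> preorder_on I r \<and> (\<forall>i\<in>I. \<forall>j\<in>I. \<exists>k\<in>I. (i, k) \<in> r \<and> (j, k) \<in> r)"

text \<open>The filter generated by the tails of a directed set; \<open>(f \<longlongrightarrow> l) (net_filter I r)\<close> is
  convergence of the net \<open>(f i)\<close>, indexed by \<open>I\<close>, to \<open>l\<close>.\<close>

definition net_filter :: "'i set \<Rightarrow> ('i \<times> 'i) set \<Rightarrow> 'i filter" where
  "net_filter I r = (INF i\<in>I. principal {j \<in> I. (i, j) \<in> r})"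

definition right_Folner_net ::
    "('s, 'm) monoid_scheme \<Rightarrow> 'i set \<Rightarrow> ('i \<times> 'i) set \<Rightarrow> ('i \<Rightarrow> 's set) \<Rightarrow> bool" where
  "right_Folner_net S I r F \<longleftrightarrow>
     directed_preorder_on I r \<and>
     (\<forall>i\<in>I. finite (F i) \<and> F i \<noteq> {} \<and> F i \<subseteq> carrier S) \<and>
     (\<forall>s\<in>carrier S.
        ((\<lambda>i. real (card ((\<lambda>x. x \<otimes>\<^bsub>S\<^esub> s) ` F i - F i)) / real (card (F i))) \<longlongrightarrow> 0)
          (net_filter I r))"

text \<open>The type argument is the type of the indices of the net. A theorem assuming
  \<open>right_amenable TYPE('i) S\<close> for a type variable \<open>'i\<close> applies to nets over arbitrary
  directed sets.\<close>

definition right_amenable :: "'i itself \<Rightarrow> ('s, 'm) monoid_scheme \<Rightarrow> bool" where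
  "right_amenable _ S \<longleftrightarrow>
     (\<exists>(I :: 'i set) r F. right_Folner_net S I r F)"


section \<open>Groups of left fractions\<close>

text \<open>The group of left fractions is determined up to a unique isomorphism compatible with the
  embeddings of \<open>S\<close>; \<open>emb\<close> plays the role of the inclusion of \<open>S\<close> in \<open>G\<close>.\<close>

definition left_fraction_group ::
    "('s, 'm) monoid_scheme \<Rightarrow> ('g, 'n) monoid_scheme \<Rightarrow> ('s \<Rightarrow> 'g) \<Rightarrow> bool" where
  "left_fraction_group S G emb \<longleftrightarrow>
     group G \<and> emb \<in> hom S G \<and> emb \<one>\<^bsub>S\<^esub> = \<one>\<^bsub>G\<^esub> \<and> inj_on emb (carrier S) \<and>
     (\<forall>g\<in>carrier G. \<exists>s\<in>carrier S. \<exists>t\<in>carrier S. g = inv\<^bsub>G\<^esub> (emb s) \<otimes>\<^bsub>G\<^esub> emb t)"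

definition frac_order ::
    "('s, 'm) monoid_scheme \<Rightarrow> ('g, 'n) monoid_scheme \<Rightarrow> ('s \<Rightarrow> 'g) \<Rightarrow> ('g \<times> 'g) set" where
  "frac_order S G emb =
     {(g1, g2). g1 \<in> carrier G \<and> g2 \<in> carrier G \<and> inv\<^bsub>G\<^esub> g2 \<otimes>\<^bsub>G\<^esub> g1 \<in> emb ` carrier S}"


section \<open>Actions by endomorphisms of Abelian groups\<close>

definition left_action ::
    "('s, 'm) monoid_scheme \<Rightarrow> ('x, 'n) monoid_scheme \<Rightarrow> ('s \<Rightarrow> 'x \<Rightarrow> 'x) \<Rightarrow> bool" where
  "left_action S A lam \<longleftrightarrow>
     comm_group A \<and>
     (\<forall>s\<in>carrier S. lam s \<in> hom A A) \<and>
     (\<forall>x\<in>carrier A. lam \<one>\<^bsub>S\<^esub> x = x) \<and>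
     (\<forall>s\<in>carrier S. \<forall>t\<in>carrier S. \<forall>x\<in>carrier A. lam (s \<otimes>\<^bsub>S\<^esub> t) x = lam s (lam t x))"

definition equivariant_hom ::
    "('s, 'm) monoid_scheme \<Rightarrow> ('x, 'n) monoid_scheme \<Rightarrow> ('s \<Rightarrow> 'x \<Rightarrow> 'x) \<Rightarrow>
     ('y, 'k) monoid_scheme \<Rightarrow> ('s \<Rightarrow> 'y \<Rightarrow> 'y) \<Rightarrow> ('x \<Rightarrow> 'y) \<Rightarrow> bool" where
  "equivariant_hom S A lam B mu \<phi> \<longleftrightarrow>
     \<phi> \<in> hom A B \<and> (\<forall>s\<in>carrier S. \<forall>x\<in>carrier A. \<phi> (lam s x) = mu s (\<phi> x))"

definition action_ker ::
    "('s, 'm) monoid_scheme \<Rightarrow> ('x, 'n) monoid_scheme \<Rightarrow> ('s \<Rightarrow> 'x \<Rightarrow> 'x) \<Rightarrow> 'x set" where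
  "action_ker S A lam = (\<Union>s\<in>carrier S. kernel A A (lam s))"

definition bar_group ::
    "('s, 'm) monoid_scheme \<Rightarrow> ('x, 'n) monoid_scheme \<Rightarrow> ('s \<Rightarrow> 'x \<Rightarrow> 'x) \<Rightarrow> 'x set monoid" where
  "bar_group S A lam = A Mod action_ker S A lam"

text \<open>The map induced on cosets: \<open>f\<close> sends every element of the coset \<open>C\<close> into a single coset
  of \<open>action_ker S B mu\<close> when \<open>f\<close> is an equivariant homomorphism, or one of the maps
  \<open>lam s\<close> of an action.\<close>

definition bar_map ::
    "('s, 'm) monoid_scheme \<Rightarrow> ('y, 'n) monoid_scheme \<Rightarrow> ('s \<Rightarrow> 'y \<Rightarrow> 'y) \<Rightarrow>
     ('x \<Rightarrow> 'y) \<Rightarrow> 'x set \<Rightarrow> 'y set" where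
  "bar_map S B mu f C = the_elem ((\<lambda>x. action_ker S B mu #>\<^bsub>B\<^esub> f x) ` C)"

definition bar_action ::
    "('s, 'm) monoid_scheme \<Rightarrow> ('x, 'n) monoid_scheme \<Rightarrow> ('s \<Rightarrow> 'x \<Rightarrow> 'x) \<Rightarrow>
     's \<Rightarrow> 'x set \<Rightarrow> 'x set" where
  "bar_action S A lam s = bar_map S A lam (lam s)"


section \<open>Direct limits\<close>

text \<open>The direct limit of groups \<open>A i\<close> over the directed set \<open>(I, r)\<close> with transition maps
  \<open>f i j\<close> from \<open>A i\<close> to \<open>A j\<close> for \<open>(i, j) \<in> r\<close>: the disjoint union of the carriers modulo
  eventual equality. The product of two classes is computed in any \<open>A k\<close> in which both have
  a representative; the unions below are over families of equal classes.\<close>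

definition direct_limit_rel ::
    "'i set \<Rightarrow> ('i \<times> 'i) set \<Rightarrow> ('i \<Rightarrow> ('a, 'n) monoid_scheme) \<Rightarrow> ('i \<Rightarrow> 'i \<Rightarrow> 'a \<Rightarrow> 'a) \<Rightarrow>
     (('i \<times> 'a) \<times> ('i \<times> 'a)) set" where
  "direct_limit_rel I r A f =
     {((i, x), (j, y)). i \<in> I \<and> x \<in> carrier (A i) \<and> j \<in> I \<and> y \<in> carrier (A j) \<and>
        (\<exists>k\<in>I. (i, k) \<in> r \<and> (j, k) \<in> r \<and> f i k x = f j k y)}"

definition direct_limit_inj ::
    "'i set \<Rightarrow> ('i \<times> 'i) set \<Rightarrow> ('i \<Rightarrow> ('a, 'n) monoid_scheme) \<Rightarrow> ('i \<Rightarrow> 'i \<Rightarrow> 'a \<Rightarrow> 'a) \<Rightarrow>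
     'i \<Rightarrow> 'a \<Rightarrow> ('i \<times> 'a) set" where
  "direct_limit_inj I r A f i x = direct_limit_rel I r A f `` {(i, x)}"

definition direct_limit ::
    "'i set \<Rightarrow> ('i \<times> 'i) set \<Rightarrow> ('i \<Rightarrow> ('a, 'n) monoid_scheme) \<Rightarrow> ('i \<Rightarrow> 'i \<Rightarrow> 'a \<Rightarrow> 'a) \<Rightarrow>
     ('i \<times> 'a) set monoid" where
  "direct_limit I r A f =
     \<lparr>carrier = (SIGMA i:I. carrier (A i)) // direct_limit_rel I r A f,
      mult = (\<lambda>P Q. \<Union>{direct_limit_inj I r A f k (f i k x \<otimes>\<^bsub>A k\<^esub> f j k y) | i x j y k.
                 (i, x) \<in> P \<and> (j, y) \<in> Q \<and> k \<in> I \<and> (i, k) \<in> r \<and> (j, k) \<in> r}),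
      one = (\<Union>i\<in>I. direct_limit_inj I r A f i \<one>\<^bsub>A i\<^esub>)\<rparr>"


section \<open>The direct limit attached to an action\<close>

text \<open>For \<open>(g1, g2) \<in> frac_order S G emb\<close> there is a unique \<open>s\<close> with \<open>g1 = g2 \<otimes> emb s\<close>, and the
  transition map is \<open>bar_action S A lam s\<close>.\<close>

definition star_transition ::
    "('s, 'm) monoid_scheme \<Rightarrow> ('g, 'n) monoid_scheme \<Rightarrow> ('s \<Rightarrow> 'g) \<Rightarrow>
     ('x, 'k) monoid_scheme \<Rightarrow> ('s \<Rightarrow> 'x \<Rightarrow> 'x) \<Rightarrow> 'g \<Rightarrow> 'g \<Rightarrow> 'x set \<Rightarrow> 'x set" where
  "star_transition S G emb A lam g1 g2 =
     bar_action S A lam (inv_into (carrier S) emb (inv\<^bsub>G\<^esub> g2 \<otimes>\<^bsub>G\<^esub> g1))"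

definition star_group ::
    "('s, 'm) monoid_scheme \<Rightarrow> ('g, 'n) monoid_scheme \<Rightarrow> ('s \<Rightarrow> 'g) \<Rightarrow>
     ('x, 'k) monoid_scheme \<Rightarrow> ('s \<Rightarrow> 'x \<Rightarrow> 'x) \<Rightarrow> ('g \<times> 'x set) set monoid" where
  "star_group S G emb A lam =
     direct_limit (carrier G) (frac_order S G emb) (\<lambda>_. bar_group S A lam)
       (star_transition S G emb A lam)"

definition star_inj ::
    "('s, 'm) monoid_scheme \<Rightarrow> ('g, 'n) monoid_scheme \<Rightarrow> ('s \<Rightarrow> 'g) \<Rightarrow>
     ('x, 'k) monoid_scheme \<Rightarrow> ('s \<Rightarrow> 'x \<Rightarrow> 'x) \<Rightarrow> 'g \<Rightarrow> 'x set \<Rightarrow> ('g \<times> 'x set) set" where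
  "star_inj S G emb A lam =
     direct_limit_inj (carrier G) (frac_order S G emb) (\<lambda>_. bar_group S A lam)
       (star_transition S G emb A lam)"

definition star_action ::
    "('s, 'm) monoid_scheme \<Rightarrow> ('g, 'n) monoid_scheme \<Rightarrow> ('s \<Rightarrow> 'g) \<Rightarrow>
     ('x, 'k) monoid_scheme \<Rightarrow> ('s \<Rightarrow> 'x \<Rightarrow> 'x) \<Rightarrow>
     ('g \<Rightarrow> ('g \<times> 'x set) set \<Rightarrow> ('g \<times> 'x set) set) \<Rightarrow> bool" where
  "star_action S G emb A lam ls \<longleftrightarrow>
     left_action G (star_group S G emb A lam) ls \<and>
     (\<forall>g\<in>carrier G. \<forall>h\<in>carrier G. \<forall>x\<in>carrier (bar_group S A lam).
        ls g (star_inj S G emb A lam h x) = star_inj S G emb A lam (g \<otimes>\<^bsub>G\<^esub> h) x)"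

definition star_hom ::
    "('s, 'm) monoid_scheme \<Rightarrow> ('g, 'n) monoid_scheme \<Rightarrow> ('s \<Rightarrow> 'g) \<Rightarrow>
     ('x, 'k) monoid_scheme \<Rightarrow> ('s \<Rightarrow> 'x \<Rightarrow> 'x) \<Rightarrow>
     ('y, 'l) monoid_scheme \<Rightarrow> ('s \<Rightarrow> 'y \<Rightarrow> 'y) \<Rightarrow> ('x \<Rightarrow> 'y) \<Rightarrow>
     (('g \<times> 'x set) set \<Rightarrow> ('g \<times> 'y set) set) \<Rightarrow> bool" where
  "star_hom S G emb A lam B mu \<phi> p \<longleftrightarrow>
     p \<in> hom (star_group S G emb A lam) (star_group S G emb B mu) \<and>
     (\<forall>g\<in>carrier G. \<forall>x\<in>carrier (bar_group S A lam).
        p (star_inj S G emb A lam g x) = star_inj S G emb B mu g (bar_map S B mu \<phi> x))"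

end

theory Submission
  imports Defs
begin

text \<open>
  The left Ore condition, here read off the existence of left fractions, makes
  \<open>Ker \<lambda>\<close> a subgroup, and two elements have the same class in \<open>X / Ker \<lambda>\<close> iff
  some \<open>\<lambda>\<^sub>s\<close> identifies them; hence every \<open>\<lambda>\<^sub>s\<close> induces an injective map on the quotient, and so are the
  canonical maps into the direct limit. Left multiplication by \<open>g\<close> is an automorphism of the
  index set that preserves the transition maps, so the universal property yields both the action
  of \<open>G\<close> and the homomorphism induced by an equivariant map.
\<close>

section \<open>Direct limits of Abelian groups\<close>

text \<open>All groups of the system share one element type, so pairs of an index and an element can
  serve as the disjoint union. The maps \<open>f i j\<close> are total functions, hence the laws for
  them are restricted to carriers.\<close>

locale direct_system =
  fixes I :: "'i set" and r :: "('i \<times> 'i) set"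
    and A :: "'i \<Rightarrow> ('a, 'n) monoid_scheme" and f :: "'i \<Rightarrow> 'i \<Rightarrow> 'a \<Rightarrow> 'a"
  assumes directed: "directed_preorder_on I r"
    and comm_group: "i \<in> I \<Longrightarrow> comm_group (A i)"
    and hom: "(i, j) \<in> r \<Longrightarrow> f i j \<in> hom (A i) (A j)"
    and trans_id: "i \<in> I \<Longrightarrow> x \<in> carrier (A i) \<Longrightarrow> f i i x = x"
    and trans_comp:
      "(i, j) \<in> r \<Longrightarrow> (j, k) \<in> r \<Longrightarrow> x \<in> carrier (A i) \<Longrightarrow> f j k (f i j x) = f i k x"
begin

abbreviation "dlim \<equiv> direct_limit I r A f"
abbreviation "dinj \<equiv> direct_limit_inj I r A f"

lemma index: "(i, j) \<in> r \<Longrightarrow> i \<in> I \<and> j \<in> I"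
  using directed by (auto simp: directed_preorder_on_def preorder_on_def)

lemma index_refl: "i \<in> I \<Longrightarrow> (i, i) \<in> r"
  using directed by (simp add: directed_preorder_on_def preorder_on_def refl_on_def)

lemma index_trans: "(i, j) \<in> r \<Longrightarrow> (j, k) \<in> r \<Longrightarrow> (i, k) \<in> r"
  using directed transD[of r i j k] by (simp add: directed_preorder_on_def preorder_on_def)

lemma upper_bound:
  assumes "i \<in> I" "j \<in> I"
  obtains k where "k \<in> I" "(i, k) \<in> r" "(j, k) \<in> r"
  using directed assms that by (auto simp: directed_preorder_on_def)

lemma trans_closed: "(i, j) \<in> r \<Longrightarrow> x \<in> carrier (A i) \<Longrightarrow> f i j x \<in> carrier (A j)"
  using hom by (rule hom_in_carrier)

section \<open>Eventual equality and its classes\<close>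

lemma rel_iff:
  "((i, x), (j, y)) \<in> direct_limit_rel I r A f \<longleftrightarrow>
     i \<in> I \<and> x \<in> carrier (A i) \<and> j \<in> I \<and> y \<in> carrier (A j) \<and>
     (\<exists>k\<in>I. (i, k) \<in> r \<and> (j, k) \<in> r \<and> f i k x = f j k y)"
  by (simp add: direct_limit_rel_def)

text \<open>Transitivity is the clause that uses upper bounds: the indices \<open>m\<close> and
  \<open>n\<close> where the two equalities hold lie below some \<open>l\<close>, and composing
  transition maps chains both equalities there.\<close>

lemma equiv_rel: "equiv (SIGMA i:I. carrier (A i)) (direct_limit_rel I r A f)"
proof (rule equivI)
  show "direct_limit_rel I r A f \<subseteq> (SIGMA i:I. carrier (A i)) \<times> (SIGMA i:I. carrier (A i))"
    by (auto simp: direct_limit_rel_def)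
  show "refl_on (SIGMA i:I. carrier (A i)) (direct_limit_rel I r A f)"
    by (auto simp: refl_on_def rel_iff intro: index_refl)
  show "sym (direct_limit_rel I r A f)"
    by (rule symI) (auto simp: direct_limit_rel_def)
  show "trans (direct_limit_rel I r A f)"
  proof (rule transI, clarify)
    fix i x j y k z
    assume "((i, x), (j, y)) \<in> direct_limit_rel I r A f"
      and "((j, y), (k, z)) \<in> direct_limit_rel I r A f"
    then obtain m n where x: "i \<in> I" "x \<in> carrier (A i)" and y: "y \<in> carrier (A j)"
      and z: "k \<in> I" "z \<in> carrier (A k)"
      and m: "m \<in> I" "(i, m) \<in> r" "(j, m) \<in> r" "f i m x = f j m y"
      and n: "n \<in> I" "(j, n) \<in> r" "(k, n) \<in> r" "f j n y = f k n z"
      unfolding rel_iff by blast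
    obtain l where l: "l \<in> I" "(m, l) \<in> r" "(n, l) \<in> r"
      using upper_bound m n by metis
    have "f i l x = f m l (f j m y)"
      using trans_comp[OF m(2) l(2) x(2)] m(4) by simp
    also have "\<dots> = f n l (f j n y)"
      using trans_comp[OF m(3) l(2) y] trans_comp[OF n(2) l(3) y] by simp
    also have "\<dots> = f k l z"
      using trans_comp[OF n(3) l(3) z(2)] n(4) by simp
    finally show "((i, x), (k, z)) \<in> direct_limit_rel I r A f"
      unfolding rel_iff using x z l m n index_trans by blast
  qed
qed

lemma inj_eq_iff:
  assumes "i \<in> I" "x \<in> carrier (A i)" "j \<in> I" "y \<in> carrier (A j)"
  shows "dinj i x = dinj j y \<longleftrightarrow> (\<exists>k\<in>I. (i, k) \<in> r \<and> (j, k) \<in> r \<and> f i k x = f j k y)"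
  unfolding direct_limit_inj_def
  using eq_equiv_class_iff[OF equiv_rel, of "(i, x)" "(j, y)"] assms by (simp add: rel_iff)

text \<open>The index \<open>j\<close> itself witnesses the eventual equality, since
  \<open>f j j\<close> is the identity.\<close>

lemma inj_trans:
  assumes ij: "(i, j) \<in> r" and x: "x \<in> carrier (A i)"
  shows "dinj j (f i j x) = dinj i x"
proof -
  have I: "i \<in> I" "j \<in> I"
    using ij index by auto
  have "f j j (f i j x) = f i j x"
    using I trans_closed[OF ij x] trans_id by blast
  then show ?thesis
    unfolding inj_eq_iff[OF I(2) trans_closed[OF ij x] I(1) x] using I ij index_refl by blast
qed

text \<open>Replaces membership in a class by an equation between classes, to which
  \<open>inj_trans\<close> and \<open>inj_eq_iff\<close> apply.\<close>

lemma mem_inj_iff: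
  assumes "i \<in> I" "x \<in> carrier (A i)"
  shows "(j, y) \<in> dinj i x \<longleftrightarrow> j \<in> I \<and> y \<in> carrier (A j) \<and> dinj j y = dinj i x"
  unfolding direct_limit_inj_def
  using equiv_class_eq_iff[OF equiv_rel, of "(i, x)" "(j, y)"] assms by auto

lemma carrier_lim: "carrier dlim = (\<Union>i\<in>I. dinj i ` carrier (A i))"
  by (auto simp: direct_limit_def direct_limit_inj_def quotient_def)

lemma limE:
  assumes "P \<in> carrier dlim"
  obtains i x where "i \<in> I" "x \<in> carrier (A i)" "P = dinj i x"
  using assms unfolding carrier_lim by blast

text \<open>A representative can be pushed to an upper bound of its own index and \<open>i\<close>.
  Using this repeatedly brings finitely many elements to one index, where they can be computed
  with.\<close>

lemma lim_at:
  assumes "P \<in> carrier dlim" "i \<in> I"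
  obtains k x where "k \<in> I" "(i, k) \<in> r" "x \<in> carrier (A k)" "P = dinj k x"
proof -
  obtain j x where j: "j \<in> I" "x \<in> carrier (A j)" "P = dinj j x"
    using assms(1) by (rule limE)
  obtain k where k: "k \<in> I" "(i, k) \<in> r" "(j, k) \<in> r"
    using assms(2) j(1) by (rule upper_bound)
  show thesis
    using k(1,2) trans_closed[OF k(3) j(2)] by (rule that) (simp add: inj_trans k(3) j)
qed

lemma inj_closed: "i \<in> I \<Longrightarrow> x \<in> carrier (A i) \<Longrightarrow> dinj i x \<in> carrier dlim"
  unfolding carrier_lim by blast

lemma common_index:
  assumes "P \<in> carrier dlim" "Q \<in> carrier dlim"
  obtains k x y where "k \<in> I" "x \<in> carrier (A k)" "y \<in> carrier (A k)" "P = dinj k x" "Q = dinj k y"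
proof -
  obtain i x where i: "i \<in> I" "x \<in> carrier (A i)" "P = dinj i x"
    using assms(1) by (rule limE)
  obtain k y where k: "k \<in> I" "(i, k) \<in> r" "y \<in> carrier (A k)" "Q = dinj k y"
    using assms(2) i(1) by (rule lim_at)
  show thesis
    using k(1) trans_closed[OF k(2) i(2)] k(3) _ k(4)
    by (rule that) (simp add: inj_trans k(2) i)
qed

section \<open>The group structure of the limit\<close>

lemma inj_mult:
  assumes "i \<in> I" "x \<in> carrier (A i)" "y \<in> carrier (A i)"
  shows "dinj i x \<otimes>\<^bsub>dlim\<^esub> dinj i y = dinj i (x \<otimes>\<^bsub>A i\<^esub> y)"
proof -
  \<comment> \<open>The product is a union over all representatives and all indices above them. Each
    choice yields the same class, because far enough along the representatives agree with the images
    of \<open>x\<close> and \<open>y\<close>.\<close>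
  have eq: "dinj k (f a k u \<otimes>\<^bsub>A k\<^esub> f b k v) = dinj i (x \<otimes>\<^bsub>A i\<^esub> y)"
    if a: "(a, u) \<in> dinj i x" and b: "(b, v) \<in> dinj i y"
      and k: "k \<in> I" "(a, k) \<in> r" "(b, k) \<in> r" for a u b v k
  proof -
    have u: "u \<in> carrier (A a)" "dinj k (f a k u) = dinj i x"
      and v: "v \<in> carrier (A b)" "dinj k (f b k v) = dinj i y"
      using a b assms k by (auto simp: mem_inj_iff inj_trans)
    have cl: "f a k u \<in> carrier (A k)" "f b k v \<in> carrier (A k)"
      using u v k trans_closed by auto
    obtain m where m: "(k, m) \<in> r" "(i, m) \<in> r" "f k m (f a k u) = f i m x"
      using u(2) unfolding inj_eq_iff[OF k(1) cl(1) assms(1,2)] by blast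
    obtain n where n: "(k, n) \<in> r" "(i, n) \<in> r" "f k n (f b k v) = f i n y"
      using v(2) unfolding inj_eq_iff[OF k(1) cl(2) assms(1,3)] by blast
    \<comment> \<open>Above \<open>m\<close> and \<open>n\<close> both agreements hold at once, and
      \<open>f k l\<close> and \<open>f i l\<close> are homomorphisms.\<close>
    obtain l where l: "(m, l) \<in> r" "(n, l) \<in> r"
      using upper_bound m n index by metis
    have kl: "(k, l) \<in> r" and il: "(i, l) \<in> r"
      using index_trans m l by blast+
    have "f k l (f a k u \<otimes>\<^bsub>A k\<^esub> f b k v) = f k l (f a k u) \<otimes>\<^bsub>A l\<^esub> f k l (f b k v)"
      using hom[OF kl] cl by (simp add: hom_mult)
    also have "f k l (f a k u) = f i l x"
      using trans_comp[OF m(1) l(1) cl(1)] trans_comp[OF m(2) l(1) assms(2)] m(3) by simp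
    also have "f k l (f b k v) = f i l y"
      using trans_comp[OF n(1) l(2) cl(2)] trans_comp[OF n(2) l(2) assms(3)] n(3) by simp
    also have "f i l x \<otimes>\<^bsub>A l\<^esub> f i l y = f i l (x \<otimes>\<^bsub>A i\<^esub> y)"
      using hom[OF il] assms by (simp add: hom_mult)
    finally have "f k l (f a k u \<otimes>\<^bsub>A k\<^esub> f b k v) = f i l (x \<otimes>\<^bsub>A i\<^esub> y)" .
    moreover have "f a k u \<otimes>\<^bsub>A k\<^esub> f b k v \<in> carrier (A k)" "x \<otimes>\<^bsub>A i\<^esub> y \<in> carrier (A i)"
      using cl assms comm_group k by (simp_all add: comm_groupE(1))
    ultimately show ?thesis
      using inj_trans kl il by metis
  qed
  \<comment> \<open>The family must also be non-empty for its union to be this class: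
    \<open>x\<close> and \<open>y\<close> at the index \<open>i\<close> provide a member.\<close>
  have "(i, x) \<in> dinj i x" "(i, y) \<in> dinj i y"
    using assms by (simp_all add: mem_inj_iff)
  then have "dinj i (f i i x \<otimes>\<^bsub>A i\<^esub> f i i y) \<in>
    {dinj k (f a k u \<otimes>\<^bsub>A k\<^esub> f b k v) | a u b v k.
      (a, u) \<in> dinj i x \<and> (b, v) \<in> dinj i y \<and> k \<in> I \<and> (a, k) \<in> r \<and> (b, k) \<in> r}" (is "_ \<in> ?F")
    using assms index_refl by blast
  moreover have "?F \<subseteq> {dinj i (x \<otimes>\<^bsub>A i\<^esub> y)}"
    using eq by blast
  ultimately have "?F = {dinj i (x \<otimes>\<^bsub>A i\<^esub> y)}"
    by blast
  then show ?thesis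
    by (simp add: direct_limit_def)
qed

lemma inj_hom: "i \<in> I \<Longrightarrow> dinj i \<in> hom (A i) dlim"
  by (simp add: hom_def inj_closed inj_mult)

text \<open>The unit of the limit is a union of the classes of all units. Transition maps preserve
  units and any two indices have an upper bound, so these classes coincide and the union is any one
  of them.\<close>

lemma inj_one:
  assumes i: "i \<in> I"
  shows "dinj i \<one>\<^bsub>A i\<^esub> = \<one>\<^bsub>dlim\<^esub>"
proof -
  have trans_one: "f i j \<one>\<^bsub>A i\<^esub> = \<one>\<^bsub>A j\<^esub>" if "(i, j) \<in> r" for i j
    using hom_one[OF hom[OF that]] index[OF that] comm_group comm_group.axioms(2) by metis
  have "dinj j \<one>\<^bsub>A j\<^esub> = dinj i \<one>\<^bsub>A i\<^esub>" if j: "j \<in> I" for j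
  proof -
    obtain k where k: "(i, k) \<in> r" "(j, k) \<in> r"
      using i j by (rule upper_bound)
    show ?thesis
      using inj_trans[OF k(1)] inj_trans[OF k(2)] comm_groupE(2)[OF comm_group] i j
      by (metis trans_one k)
  qed
  then have "(\<Union>j\<in>I. dinj j \<one>\<^bsub>A j\<^esub>) = (\<Union>j\<in>I. dinj i \<one>\<^bsub>A i\<^esub>)"
    by (rule SUP_cong[OF refl])
  then show ?thesis
    using i by (auto simp: direct_limit_def)
qed

lemma comm_group_lim: "comm_group dlim"
proof (rule comm_groupI)
  obtain i where i: "i \<in> I"
    using directed unfolding directed_preorder_on_def by blast
  show "\<one>\<^bsub>dlim\<^esub> \<in> carrier dlim"
    using inj_one[OF i] inj_closed[OF i] comm_groupE(2)[OF comm_group[OF i]] by metis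
next
  fix P Q assume "P \<in> carrier dlim" "Q \<in> carrier dlim"
  then obtain k x y where k: "k \<in> I" "x \<in> carrier (A k)" "y \<in> carrier (A k)"
    "P = dinj k x" "Q = dinj k y"
    by (rule common_index)
  then show "P \<otimes>\<^bsub>dlim\<^esub> Q \<in> carrier dlim" "P \<otimes>\<^bsub>dlim\<^esub> Q = Q \<otimes>\<^bsub>dlim\<^esub> P"
    using comm_groupE(1,4)[OF comm_group[OF k(1)]] by (simp_all add: inj_mult inj_closed)
next
  fix P Q R assume PQ: "P \<in> carrier dlim" "Q \<in> carrier dlim" and R: "R \<in> carrier dlim"
  obtain i x y where i: "i \<in> I" "x \<in> carrier (A i)" "y \<in> carrier (A i)"
    "P = dinj i x" "Q = dinj i y"
    using PQ by (rule common_index)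
  \<comment> \<open>Associativity involves three elements: \<open>R\<close> gets a representative
    above the index shared by \<open>P\<close> and \<open>Q\<close>, which are then moved up to
    it.\<close>
  obtain k z where k: "k \<in> I" "(i, k) \<in> r" "z \<in> carrier (A k)" "R = dinj k z"
    using R i(1) by (rule lim_at)
  have "P = dinj k (f i k x)" "Q = dinj k (f i k y)"
    using i k inj_trans by simp_all
  then show "P \<otimes>\<^bsub>dlim\<^esub> Q \<otimes>\<^bsub>dlim\<^esub> R = P \<otimes>\<^bsub>dlim\<^esub> (Q \<otimes>\<^bsub>dlim\<^esub> R)"
    using k i trans_closed comm_groupE(1,3)[OF comm_group[OF k(1)]] by (simp add: inj_mult)
next
  fix P assume "P \<in> carrier dlim"
  then obtain i x where i: "i \<in> I" "x \<in> carrier (A i)" "P = dinj i x"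
    by (rule limE)
  interpret comm_group "A i"
    using i(1) by (rule comm_group)
  show "\<one>\<^bsub>dlim\<^esub> \<otimes>\<^bsub>dlim\<^esub> P = P"
    using i inj_mult[of i "\<one>\<^bsub>A i\<^esub>" x] by (simp add: inj_one)
  have "dinj i (inv\<^bsub>A i\<^esub> x) \<otimes>\<^bsub>dlim\<^esub> P = \<one>\<^bsub>dlim\<^esub>"
    using i by (simp add: inj_mult inj_one)
  then show "\<exists>Q\<in>carrier dlim. Q \<otimes>\<^bsub>dlim\<^esub> P = \<one>\<^bsub>dlim\<^esub>"
    using i inj_closed by blast
qed

section \<open>The universal property\<close>

lemma universal_property:
  assumes h: "\<And>i. i \<in> I \<Longrightarrow> h i \<in> hom (A i) Z"
    and compat: "\<And>i j x. (i, j) \<in> r \<Longrightarrow> x \<in> carrier (A i) \<Longrightarrow> h j (f i j x) = h i x"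
  obtains p where "p \<in> hom dlim Z" "p \<in> extensional (carrier dlim)"
    "\<And>i x. i \<in> I \<Longrightarrow> x \<in> carrier (A i) \<Longrightarrow> p (dinj i x) = h i x"
proof -
  \<comment> \<open>On a class, \<open>p\<close> takes the common value of the maps \<open>h\<close>
    on all its members: two members agree after transition maps, and \<open>compat\<close> carries
    this back to their own indices. The restriction to the carrier fixes the values elsewhere, which
    uniqueness as a function requires.\<close>
  define p where "p = (\<lambda>P\<in>carrier dlim. the_elem ((\<lambda>(i, x). h i x) ` P))"
  have p: "p (dinj i x) = h i x" if i: "i \<in> I" "x \<in> carrier (A i)" for i x
  proof -
    have "h j y = h i x" if "(j, y) \<in> dinj i x" for j y
    proof -
      have j: "j \<in> I" "y \<in> carrier (A j)" "dinj j y = dinj i x"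
        using that mem_inj_iff[OF i] by auto
      then obtain k where k: "(j, k) \<in> r" "(i, k) \<in> r" "f j k y = f i k x"
        using inj_eq_iff[OF j(1,2) i] by blast
      then show ?thesis
        using compat[OF k(1) j(2)] compat[OF k(2) i(2)] by simp
    qed
    then have "(\<lambda>(i, x). h i x) ` dinj i x \<subseteq> {h i x}"
      by auto
    moreover have "(i, x) \<in> dinj i x"
      using i by (simp add: mem_inj_iff)
    ultimately have "(\<lambda>(i, x). h i x) ` dinj i x = {h i x}"
      by blast
    then show ?thesis
      using i inj_closed by (simp add: p_def)
  qed
  have p_hom: "p \<in> hom dlim Z"
  proof (rule homI)
    fix P assume "P \<in> carrier dlim"
    then show "p P \<in> carrier Z"
      by (rule limE) (simp add: p hom_in_carrier[OF h])
  next
    fix P Q assume "P \<in> carrier dlim" "Q \<in> carrier dlim"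
    then obtain k x y where k: "k \<in> I" "x \<in> carrier (A k)" "y \<in> carrier (A k)"
      "P = dinj k x" "Q = dinj k y"
      by (rule common_index)
    then show "p (P \<otimes>\<^bsub>dlim\<^esub> Q) = p P \<otimes>\<^bsub>Z\<^esub> p Q"
      using comm_groupE(1)[OF comm_group[OF k(1)]]
      by (simp add: inj_mult p hom_mult[OF h[OF k(1)]])
  qed
  have "p \<in> extensional (carrier dlim)"
    by (simp add: p_def)
  with p_hom show thesis
    using p by (rule that)
qed

text \<open>The uniqueness half of the universal property: the images of the canonical maps exhaust
  the limit.\<close>

lemma extensional_eqI:
  assumes "p \<in> extensional (carrier dlim)" "q \<in> extensional (carrier dlim)"
    and "\<And>i x. i \<in> I \<Longrightarrow> x \<in> carrier (A i) \<Longrightarrow> p (dinj i x) = q (dinj i x)"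
  shows "p = q"
  using assms(1,2)
proof (rule extensionalityI)
  fix P assume "P \<in> carrier dlim"
  then show "p P = q P"
    by (rule limE) (simp add: assms(3))
qed

end

section \<open>Actions of monoids with a group of left fractions\<close>

locale left_fractions = S?: monoid_cancel S + G?: group G
  for S :: "('s, 'm) monoid_scheme" and G :: "('g, 'n) monoid_scheme" and emb :: "'s \<Rightarrow> 'g" +
  assumes fractions: "left_fraction_group S G emb"
begin

lemma emb_closed: "s \<in> carrier S \<Longrightarrow> emb s \<in> carrier G"
  using fractions unfolding left_fraction_group_def by (auto dest: hom_in_carrier)

lemma emb_mult:
  "s \<in> carrier S \<Longrightarrow> t \<in> carrier S \<Longrightarrow> emb (s \<otimes>\<^bsub>S\<^esub> t) = emb s \<otimes>\<^bsub>G\<^esub> emb t"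
  using fractions unfolding left_fraction_group_def by (auto simp: hom_mult)

lemma emb_one: "emb \<one>\<^bsub>S\<^esub> = \<one>\<^bsub>G\<^esub>"
  using fractions unfolding left_fraction_group_def by auto

lemma emb_inj: "inj_on emb (carrier S)"
  using fractions unfolding left_fraction_group_def by auto

lemma fractionE:
  assumes "g \<in> carrier G"
  obtains s t where "s \<in> carrier S" "t \<in> carrier S" "g = inv\<^bsub>G\<^esub> emb s \<otimes>\<^bsub>G\<^esub> emb t"
  using fractions assms unfolding left_fraction_group_def by blast

text \<open>Writing \<open>s t\<^sup>-\<^sup>1\<close> as a left fraction \<open>u\<^sup>-\<^sup>1 v\<close>.\<close>

lemma left_Ore:
  assumes "s \<in> carrier S" "t \<in> carrier S"
  obtains u v where "u \<in> carrier S" "v \<in> carrier S" "u \<otimes>\<^bsub>S\<^esub> s = v \<otimes>\<^bsub>S\<^esub> t"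
proof -
  have "emb s \<otimes>\<^bsub>G\<^esub> inv\<^bsub>G\<^esub> emb t \<in> carrier G"
    using assms emb_closed by simp
  then obtain u v where uv: "u \<in> carrier S" "v \<in> carrier S"
    "emb s \<otimes>\<^bsub>G\<^esub> inv\<^bsub>G\<^esub> emb t = inv\<^bsub>G\<^esub> emb u \<otimes>\<^bsub>G\<^esub> emb v"
    by (rule fractionE)
  have "emb s = inv\<^bsub>G\<^esub> emb u \<otimes>\<^bsub>G\<^esub> emb v \<otimes>\<^bsub>G\<^esub> emb t"
    using uv assms emb_closed by (metis G.inv_closed G.inv_solve_right G.m_closed)
  then have "emb u \<otimes>\<^bsub>G\<^esub> emb s = emb v \<otimes>\<^bsub>G\<^esub> emb t"
    using uv assms emb_closed by (simp add: G.m_assoc[symmetric])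
  then have "emb (u \<otimes>\<^bsub>S\<^esub> s) = emb (v \<otimes>\<^bsub>S\<^esub> t)"
    using uv assms by (simp add: emb_mult)
  then have "u \<otimes>\<^bsub>S\<^esub> s = v \<otimes>\<^bsub>S\<^esub> t"
    using emb_inj uv assms by (simp add: inj_on_eq_iff)
  with uv that show thesis by blast
qed

text \<open>The form \<open>g = h s\<close> exhibits the element \<open>s\<close> along which the
  transition map from \<open>g\<close> to \<open>h\<close> acts.\<close>

lemma frac_order_iff:
  "(g, h) \<in> frac_order S G emb \<longleftrightarrow> h \<in> carrier G \<and> (\<exists>s\<in>carrier S. g = h \<otimes>\<^bsub>G\<^esub> emb s)"
proof
  assume "(g, h) \<in> frac_order S G emb"
  then obtain s where "g \<in> carrier G" "h \<in> carrier G" "s \<in> carrier S"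
    "inv\<^bsub>G\<^esub> h \<otimes>\<^bsub>G\<^esub> g = emb s"
    unfolding frac_order_def by blast
  then show "h \<in> carrier G \<and> (\<exists>s\<in>carrier S. g = h \<otimes>\<^bsub>G\<^esub> emb s)"
    using emb_closed by (metis G.inv_solve_left')
next
  assume "h \<in> carrier G \<and> (\<exists>s\<in>carrier S. g = h \<otimes>\<^bsub>G\<^esub> emb s)"
  then show "(g, h) \<in> frac_order S G emb"
    by (auto simp: frac_order_def emb_closed G.m_assoc[symmetric])
qed

lemma frac_orderE:
  assumes "(g, h) \<in> frac_order S G emb"
  obtains s where "h \<in> carrier G" "s \<in> carrier S" "g = h \<otimes>\<^bsub>G\<^esub> emb s"
  using assms unfolding frac_order_iff by blast

lemma directed_frac_order: "directed_preorder_on (carrier G) (frac_order S G emb)"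
  unfolding directed_preorder_on_def preorder_on_def
proof (intro conjI ballI)
  show "carrier G \<noteq> {}"
    using G.one_closed by blast
  show "frac_order S G emb \<subseteq> carrier G \<times> carrier G"
    unfolding frac_order_def by blast
  show "refl_on (carrier G) (frac_order S G emb)"
    by (auto simp: refl_on_def frac_order_iff emb_one intro!: bexI[of _ "\<one>\<^bsub>S\<^esub>"])
  show "trans (frac_order S G emb)"
  proof (rule transI)
    fix g h k assume gh: "(g, h) \<in> frac_order S G emb" and hk: "(h, k) \<in> frac_order S G emb"
    obtain s where s: "s \<in> carrier S" "g = h \<otimes>\<^bsub>G\<^esub> emb s"
      using gh by (rule frac_orderE)
    obtain t where t: "k \<in> carrier G" "t \<in> carrier S" "h = k \<otimes>\<^bsub>G\<^esub> emb t"
      using hk by (rule frac_orderE)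
    have "g = k \<otimes>\<^bsub>G\<^esub> emb (t \<otimes>\<^bsub>S\<^esub> s)"
      using s t emb_closed by (simp add: emb_mult G.m_assoc)
    with s t show "(g, k) \<in> frac_order S G emb"
      unfolding frac_order_iff by blast
  qed
next
  fix g h assume g: "g \<in> carrier G" and h: "h \<in> carrier G"
  then have "inv\<^bsub>G\<^esub> g \<otimes>\<^bsub>G\<^esub> h \<in> carrier G"
    by simp
  then obtain s t where st: "s \<in> carrier S" "t \<in> carrier S"
    "inv\<^bsub>G\<^esub> g \<otimes>\<^bsub>G\<^esub> h = inv\<^bsub>G\<^esub> emb s \<otimes>\<^bsub>G\<^esub> emb t"
    by (rule fractionE)
  \<comment> \<open>From \<open>g^-1 h = s^-1 t\<close> follows \<open>g s^-1 = h t^-1\<close>; this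
    element lies above both \<open>g\<close> and \<open>h\<close>.\<close>
  define k where "k = g \<otimes>\<^bsub>G\<^esub> inv\<^bsub>G\<^esub> emb s"
  have k: "k \<in> carrier G"
    using g st emb_closed by (simp add: k_def)
  have "g = k \<otimes>\<^bsub>G\<^esub> emb s"
    using g st emb_closed by (simp add: k_def G.m_assoc)
  moreover have "h = k \<otimes>\<^bsub>G\<^esub> emb t"
    using g h st emb_closed by (simp add: k_def G.m_assoc G.inv_solve_left')
  ultimately show "\<exists>k\<in>carrier G. (g, k) \<in> frac_order S G emb \<and> (h, k) \<in> frac_order S G emb"
    using k st unfolding frac_order_iff by blast
qed

text \<open>Cancelling \<open>g\<close> leaves \<open>emb s\<close>, from which injectivity of
  \<open>emb\<close> recovers \<open>s\<close>.\<close>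

lemma star_transition_eq:
  "g \<in> carrier G \<Longrightarrow> s \<in> carrier S \<Longrightarrow>
     star_transition S G emb A lam (g \<otimes>\<^bsub>G\<^esub> emb s) g = bar_action S A lam s"
  by (simp add: star_transition_def G.m_assoc[symmetric] emb_closed emb_inj)

end

section \<open>The kernel of an action and the quotient by it\<close>

locale fraction_action = left_fractions S G emb + A?: comm_group A
  for S :: "('s, 'm) monoid_scheme" and G :: "('g, 'n) monoid_scheme" and emb :: "'s \<Rightarrow> 'g"
    and A :: "('x, 'k) monoid_scheme" and lam :: "'s \<Rightarrow> 'x \<Rightarrow> 'x" +
  assumes action: "left_action S A lam"
begin

abbreviation "proj x \<equiv> action_ker S A lam #>\<^bsub>A\<^esub> x"
abbreviation "bar \<equiv> bar_group S A lam"
abbreviation "star \<equiv> star_group S G emb A lam"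
abbreviation "eps \<equiv> star_inj S G emb A lam"

lemma lam_hom: "s \<in> carrier S \<Longrightarrow> lam s \<in> hom A A"
  using action unfolding left_action_def by blast

lemma lam_closed: "s \<in> carrier S \<Longrightarrow> x \<in> carrier A \<Longrightarrow> lam s x \<in> carrier A"
  using lam_hom hom_in_carrier by metis

lemma lam_group_hom: "s \<in> carrier S \<Longrightarrow> group_hom A A (lam s)"
  using lam_hom by (simp add: group_hom_def group_hom_axioms_def A.group_axioms)

lemma lam_mult:
  "s \<in> carrier S \<Longrightarrow> t \<in> carrier S \<Longrightarrow> x \<in> carrier A \<Longrightarrow> lam (s \<otimes>\<^bsub>S\<^esub> t) x = lam s (lam t x)"
  using action unfolding left_action_def by blast

lemma lam_one: "x \<in> carrier A \<Longrightarrow> lam \<one>\<^bsub>S\<^esub> x = x"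
  using action unfolding left_action_def by blast

lemma mem_ker_iff:
  "x \<in> action_ker S A lam \<longleftrightarrow> x \<in> carrier A \<and> (\<exists>s\<in>carrier S. lam s x = \<one>\<^bsub>A\<^esub>)"
  unfolding action_ker_def kernel_def by blast

text \<open>Closure under products rests on the Ore condition: if \<open>lam s\<close> kills
  \<open>x\<close> and \<open>lam t\<close> kills \<open>y\<close>, then a common left multiple
  \<open>u s = v t\<close> kills both, hence their product.\<close>

lemma subgroup_ker: "subgroup (action_ker S A lam) A"
proof (rule A.subgroupI)
  show "action_ker S A lam \<subseteq> carrier A"
    unfolding action_ker_def kernel_def by blast
  show "action_ker S A lam \<noteq> {}"
    using lam_one[of "\<one>\<^bsub>A\<^esub>"] mem_ker_iff by blast
  show "inv\<^bsub>A\<^esub> x \<in> action_ker S A lam" if "x \<in> action_ker S A lam" for x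
  proof -
    obtain s where "x \<in> carrier A" "s \<in> carrier S" "lam s x = \<one>\<^bsub>A\<^esub>"
      using \<open>x \<in> action_ker S A lam\<close> unfolding mem_ker_iff by blast
    then show ?thesis
      unfolding mem_ker_iff
      by (intro conjI bexI[of _ s]) (simp_all add: group_hom.hom_inv[OF lam_group_hom])
  qed
next
  fix x y assume "x \<in> action_ker S A lam" "y \<in> action_ker S A lam"
  then obtain s t where x: "x \<in> carrier A" "s \<in> carrier S" "lam s x = \<one>\<^bsub>A\<^esub>"
    and y: "y \<in> carrier A" "t \<in> carrier S" "lam t y = \<one>\<^bsub>A\<^esub>"
    unfolding mem_ker_iff by blast
  obtain u v where uv: "u \<in> carrier S" "v \<in> carrier S" "u \<otimes>\<^bsub>S\<^esub> s = v \<otimes>\<^bsub>S\<^esub> t"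
    using left_Ore x(2) y(2) by blast
  have "lam (u \<otimes>\<^bsub>S\<^esub> s) x = \<one>\<^bsub>A\<^esub>" "lam (u \<otimes>\<^bsub>S\<^esub> s) y = \<one>\<^bsub>A\<^esub>"
    using x y uv lam_mult[of u s x] lam_mult[of v t y]
    by (simp_all add: group_hom.hom_one[OF lam_group_hom])
  then have "lam (u \<otimes>\<^bsub>S\<^esub> s) (x \<otimes>\<^bsub>A\<^esub> y) = \<one>\<^bsub>A\<^esub>"
    using x y uv(1) by (simp add: hom_mult[OF lam_hom])
  then show "x \<otimes>\<^bsub>A\<^esub> y \<in> action_ker S A lam"
    unfolding mem_ker_iff using x y uv by blast
qed

lemma comm_group_bar: "comm_group bar"
  unfolding bar_group_def using subgroup_ker by (rule A.abelian_FactGroup)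

lemma carrier_bar: "carrier bar = proj ` carrier A"
  unfolding bar_group_def carrier_FactGroup ..

text \<open>The cosets agree iff the quotient of \<open>x\<close> by \<open>y\<close> lies in the
  kernel, and the homomorphism \<open>lam s\<close> kills that quotient exactly when it identifies
  \<open>x\<close> and \<open>y\<close>.\<close>

lemma proj_eq_iff:
  assumes "x \<in> carrier A" "y \<in> carrier A"
  shows "proj x = proj y \<longleftrightarrow> (\<exists>s\<in>carrier S. lam s x = lam s y)"
proof -
  have "proj x = proj y \<longleftrightarrow> x \<otimes>\<^bsub>A\<^esub> inv\<^bsub>A\<^esub> y \<in> action_ker S A lam"
    using assms subgroup_ker
    by (metis A.rcos_self A.repr_independence A.group_axioms subgroup.rcos_module)
  also have "\<dots> \<longleftrightarrow> (\<exists>s\<in>carrier S. lam s x = lam s y)"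
    unfolding mem_ker_iff using assms lam_closed
    by (auto simp: hom_mult[OF lam_hom] group_hom.hom_inv[OF lam_group_hom] A.inv_solve_right'
        cong: bex_cong)
  finally show ?thesis .
qed

text \<open>The congruence hypothesis makes the image set in \<open>bar_map\<close> a singleton. The
  target \<open>B\<close> and the map \<open>h\<close> are left general, so that the lemma serves
  the maps \<open>lam s\<close> as well as equivariant homomorphisms.\<close>

lemma bar_map_proj:
  assumes x: "x \<in> carrier A"
    and cong: "\<And>y. y \<in> carrier A \<Longrightarrow> proj x = proj y \<Longrightarrow>
      action_ker S B mu #>\<^bsub>B\<^esub> h x = action_ker S B mu #>\<^bsub>B\<^esub> h y"
  shows "bar_map S B mu h (proj x) = action_ker S B mu #>\<^bsub>B\<^esub> h x"
proof -
  have "action_ker S B mu #>\<^bsub>B\<^esub> h y = action_ker S B mu #>\<^bsub>B\<^esub> h x" if y: "y \<in> proj x" for y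
  proof (rule cong[symmetric])
    show "y \<in> carrier A"
      using A.r_coset_subset_G[OF subgroup.subset[OF subgroup_ker] x] y by (rule subsetD)
    show "proj x = proj y"
      using y x subgroup_ker by (rule A.repr_independence)
  qed
  moreover have "proj x \<noteq> {}"
    using A.rcos_self[OF x subgroup_ker] by auto
  ultimately have "(\<lambda>y. action_ker S B mu #>\<^bsub>B\<^esub> h y) ` proj x = {action_ker S B mu #>\<^bsub>B\<^esub> h x}"
    by (simp add: image_constant_conv cong: image_cong_simp)
  then show ?thesis
    by (simp add: bar_map_def)
qed

lemma proj_mult:
  "x \<in> carrier A \<Longrightarrow> y \<in> carrier A \<Longrightarrow> proj x \<otimes>\<^bsub>bar\<^esub> proj y = proj (x \<otimes>\<^bsub>A\<^esub> y)"
  using subgroup_ker by (simp add: bar_group_def normal.rcos_sum A.normal_iff_subgroup)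

text \<open>Well-definedness on cosets: if \<open>lam t\<close> identifies \<open>x\<close> and
  \<open>y\<close>, choose \<open>u s = v t\<close>; then \<open>lam u\<close> identifies
  \<open>lam s x\<close> and \<open>lam s y\<close>.\<close>

lemma bar_action_proj:
  assumes s: "s \<in> carrier S" and x: "x \<in> carrier A"
  shows "bar_action S A lam s (proj x) = proj (lam s x)"
  unfolding bar_action_def
proof (rule bar_map_proj[OF x])
  fix y assume y: "y \<in> carrier A" and "proj x = proj y"
  then obtain t where t: "t \<in> carrier S" "lam t x = lam t y"
    using proj_eq_iff[OF x y] by blast
  obtain u v where uv: "u \<in> carrier S" "v \<in> carrier S" "u \<otimes>\<^bsub>S\<^esub> s = v \<otimes>\<^bsub>S\<^esub> t"
    using left_Ore s t(1) by blast
  have "lam u (lam s x) = lam u (lam s y)"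
    using lam_mult[OF uv(1) s x] lam_mult[OF uv(1) s y] lam_mult[OF uv(2) t(1) x]
      lam_mult[OF uv(2) t(1) y] uv(3) t(2) by simp
  then show "proj (lam s x) = proj (lam s y)"
    using uv(1) unfolding proj_eq_iff[OF lam_closed[OF s x] lam_closed[OF s y]] by blast
qed

lemma bar_action_hom: "s \<in> carrier S \<Longrightarrow> bar_action S A lam s \<in> hom bar bar"
  by (rule homI)
    (auto simp: carrier_bar bar_action_proj lam_closed proj_mult hom_mult[OF lam_hom])

text \<open>Here it matters that the kernel collects all of \<open>S\<close>: if
  \<open>lam t\<close> identifies \<open>lam s x\<close> and \<open>lam s y\<close>, then
  \<open>lam (t s)\<close> identifies \<open>x\<close> and \<open>y\<close>.\<close>

lemma bar_action_inj:
  assumes s: "s \<in> carrier S"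
  shows "inj_on (bar_action S A lam s) (carrier bar)"
proof (rule inj_onI)
  fix C D assume "C \<in> carrier bar" "D \<in> carrier bar"
    and eq: "bar_action S A lam s C = bar_action S A lam s D"
  then obtain x y where xy: "x \<in> carrier A" "y \<in> carrier A" "C = proj x" "D = proj y"
    unfolding carrier_bar by blast
  then have "proj (lam s x) = proj (lam s y)"
    using eq s by (simp add: bar_action_proj)
  then obtain t where t: "t \<in> carrier S" "lam t (lam s x) = lam t (lam s y)"
    using proj_eq_iff[OF lam_closed[OF s xy(1)] lam_closed[OF s xy(2)]] by blast
  then have "lam (t \<otimes>\<^bsub>S\<^esub> s) x = lam (t \<otimes>\<^bsub>S\<^esub> s) y"
    using xy s by (simp add: lam_mult)
  then show "C = D"
    using s t(1) unfolding xy(3,4) proj_eq_iff[OF xy(1,2)] by blast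
qed

section \<open>The direct limit attached to an action\<close>

sublocale star: direct_system "carrier G" "frac_order S G emb" "\<lambda>_. bar"
  "star_transition S G emb A lam"
  rewrites "direct_limit (carrier G) (frac_order S G emb) (\<lambda>_. bar)
      (star_transition S G emb A lam) = star"
    and "direct_limit_inj (carrier G) (frac_order S G emb) (\<lambda>_. bar)
      (star_transition S G emb A lam) = eps"
proof -
  show "direct_system (carrier G) (frac_order S G emb) (\<lambda>_. bar) (star_transition S G emb A lam)"
  proof (rule direct_system.intro)
    show "directed_preorder_on (carrier G) (frac_order S G emb)"
      by (rule directed_frac_order)
    show "comm_group bar"
      by (rule comm_group_bar)
  next
    fix g h assume "(g, h) \<in> frac_order S G emb"
    then show "star_transition S G emb A lam g h \<in> hom bar bar"
      by (auto elim!: frac_orderE simp: star_transition_eq bar_action_hom)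
  next
    fix g C assume "g \<in> carrier G" "C \<in> carrier bar"
    then show "star_transition S G emb A lam g g C = C"
      using star_transition_eq[of g "\<one>\<^bsub>S\<^esub>" A lam]
      by (auto simp: emb_one carrier_bar bar_action_proj lam_one)
  next
    fix g h k C assume gh: "(g, h) \<in> frac_order S G emb" and hk: "(h, k) \<in> frac_order S G emb"
      and C: "C \<in> carrier bar"
    obtain s where s: "s \<in> carrier S" "g = h \<otimes>\<^bsub>G\<^esub> emb s"
      using gh by (rule frac_orderE)
    obtain t where t: "k \<in> carrier G" "t \<in> carrier S" "h = k \<otimes>\<^bsub>G\<^esub> emb t"
      using hk by (rule frac_orderE)
    have h: "h \<in> carrier G"
      using t emb_closed by simp
    \<comment> \<open>The factors combine as \<open>t s\<close>, the order in which
      \<open>lam (t s)\<close> applies \<open>lam s\<close> first, just as the index passes from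
      \<open>g\<close> to \<open>h\<close> and then to \<open>k\<close>.\<close>
    have g: "g = k \<otimes>\<^bsub>G\<^esub> emb (t \<otimes>\<^bsub>S\<^esub> s)"
      using s t emb_closed by (simp add: emb_mult G.m_assoc)
    have "star_transition S G emb A lam g h = bar_action S A lam s"
      using s h star_transition_eq by blast
    moreover have "star_transition S G emb A lam h k = bar_action S A lam t"
      using t star_transition_eq by blast
    moreover have "star_transition S G emb A lam g k = bar_action S A lam (t \<otimes>\<^bsub>S\<^esub> s)"
      unfolding g using s t by (simp add: star_transition_eq)
    ultimately show "star_transition S G emb A lam h k (star_transition S G emb A lam g h C) =
        star_transition S G emb A lam g k C"
      using C s t by (auto simp: carrier_bar bar_action_proj lam_closed lam_mult)
  qed
qed (simp_all add: star_group_def star_inj_def)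

text \<open>\<open>inj_trans\<close> in multiplicative form: \<open>g s\<close> lies below
  \<open>g\<close>, and the transition between them is the action of \<open>s\<close>.\<close>

lemma eps_transition:
  assumes "g \<in> carrier G" "s \<in> carrier S" "x \<in> carrier bar"
  shows "eps g (bar_action S A lam s x) = eps (g \<otimes>\<^bsub>G\<^esub> emb s) x"
  using star.inj_trans[of "g \<otimes>\<^bsub>G\<^esub> emb s" g x] assms
  by (auto simp: frac_order_iff star_transition_eq)

text \<open>Elements with equal images in the limit agree after some transition map, and every
  transition map is injective by \<open>bar_action_inj\<close>.\<close>

lemma eps_inj: "g \<in> carrier G \<Longrightarrow> inj_on (eps g) (carrier bar)"
proof (rule inj_onI)
  fix x y assume g: "g \<in> carrier G" and xy: "x \<in> carrier bar" "y \<in> carrier bar" "eps g x = eps g y"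
  then obtain k where k: "(g, k) \<in> frac_order S G emb"
    and eq: "star_transition S G emb A lam g k x = star_transition S G emb A lam g k y"
    using star.inj_eq_iff by blast
  obtain s where "k \<in> carrier G" "s \<in> carrier S" "g = k \<otimes>\<^bsub>G\<^esub> emb s"
    using k by (rule frac_orderE)
  then show "x = y"
    using eq xy(1,2) by (simp add: star_transition_eq inj_on_eq_iff[OF bar_action_inj])
qed

section \<open>The action of the group of fractions on the limit\<close>

lemma hom_left_mult:
  assumes g: "g \<in> carrier G"
  obtains p where "p \<in> hom star star" "p \<in> extensional (carrier star)"
    "\<And>h x. h \<in> carrier G \<Longrightarrow> x \<in> carrier bar \<Longrightarrow> p (eps h x) = eps (g \<otimes>\<^bsub>G\<^esub> h) x"
proof (rule star.universal_property[of "\<lambda>h. eps (g \<otimes>\<^bsub>G\<^esub> h)" star])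
  show "eps (g \<otimes>\<^bsub>G\<^esub> h) \<in> hom bar star" if "h \<in> carrier G" for h
    using that g star.inj_hom by simp
  \<comment> \<open>If \<open>h = k s\<close> then \<open>g h = (g k) s\<close>: left multiplication
    keeps the right factor \<open>s\<close>, which alone determines the transition map.\<close>
  show "eps (g \<otimes>\<^bsub>G\<^esub> k) (star_transition S G emb A lam h k x) = eps (g \<otimes>\<^bsub>G\<^esub> h) x"
    if "(h, k) \<in> frac_order S G emb" "x \<in> carrier bar" for h k x
    using that g
    by (auto elim!: frac_orderE simp: star_transition_eq eps_transition G.m_assoc emb_closed)
qed (use that in blast)

lemma star_actionD:
  assumes "star_action S G emb A lam ls"
  shows "g \<in> carrier G \<Longrightarrow> ls g \<in> hom star star"
    and "g \<in> carrier G \<Longrightarrow> h \<in> carrier G \<Longrightarrow> x \<in> carrier bar \<Longrightarrow>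
      ls g (eps h x) = eps (g \<otimes>\<^bsub>G\<^esub> h) x"
  using assms by (simp_all add: star_action_def left_action_def)

text \<open>The extensional function space fixes the values outside the carriers, so uniqueness can
  be stated as equality of functions.\<close>

lemma ex1_star_action:
  "\<exists>!ls. ls \<in> carrier G \<rightarrow>\<^sub>E (carrier star \<rightarrow>\<^sub>E carrier star) \<and> star_action S G emb A lam ls"
proof (rule ex_ex1I)
  have "\<forall>g\<in>carrier G. \<exists>p. p \<in> hom star star \<and> p \<in> extensional (carrier star) \<and>
      (\<forall>h\<in>carrier G. \<forall>x\<in>carrier bar. p (eps h x) = eps (g \<otimes>\<^bsub>G\<^esub> h) x)"
    using hom_left_mult by metis
  then obtain l where l_hom: "\<And>g. g \<in> carrier G \<Longrightarrow> l g \<in> hom star star"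
    and l_ext: "\<And>g. g \<in> carrier G \<Longrightarrow> l g \<in> extensional (carrier star)"
    and l_eps: "\<And>g h x. g \<in> carrier G \<Longrightarrow> h \<in> carrier G \<Longrightarrow> x \<in> carrier bar \<Longrightarrow>
      l g (eps h x) = eps (g \<otimes>\<^bsub>G\<^esub> h) x"
    by metis
  \<comment> \<open>Every element of the limit is some \<open>eps h x\<close>, and on these the
    action laws become the unit law and associativity of \<open>G\<close>.\<close>
  have "left_action G star (restrict l (carrier G))"
    unfolding left_action_def
    by (auto simp: star.comm_group_lim l_hom l_eps G.m_assoc elim!: star.limE)
  then have "star_action S G emb A lam (restrict l (carrier G))"
    unfolding star_action_def by (simp add: l_eps)
  moreover have "restrict l (carrier G) \<in> carrier G \<rightarrow>\<^sub>E (carrier star \<rightarrow>\<^sub>E carrier star)"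
    using l_hom l_ext by (auto simp: hom_def PiE_def)
  ultimately show "\<exists>ls. ls \<in> carrier G \<rightarrow>\<^sub>E (carrier star \<rightarrow>\<^sub>E carrier star) \<and>
      star_action S G emb A lam ls"
    by blast
next
  fix ls ms
  assume ls: "ls \<in> carrier G \<rightarrow>\<^sub>E (carrier star \<rightarrow>\<^sub>E carrier star) \<and> star_action S G emb A lam ls"
    and ms: "ms \<in> carrier G \<rightarrow>\<^sub>E (carrier star \<rightarrow>\<^sub>E carrier star) \<and> star_action S G emb A lam ms"
  show "ls = ms"
  proof (rule PiE_ext[of _ _ "\<lambda>_. carrier star \<rightarrow>\<^sub>E carrier star"])
    fix g assume g: "g \<in> carrier G"
    show "ls g = ms g"
    proof (rule star.extensional_eqI)
      show "ls g \<in> extensional (carrier star)" "ms g \<in> extensional (carrier star)"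
        using ls ms g by (auto simp: PiE_def Pi_def)
    qed (use ls ms g star_actionD in metis)
  qed (use ls ms in blast)+
qed

text \<open>Both sides equal \<open>eps (emb s) x\<close>: one by \<open>eps_transition\<close> at
  the unit, the other by the defining property of the action.\<close>

lemma eps_one_equivariant:
  assumes "star_action S G emb A lam ls"
  shows "equivariant_hom S bar (bar_action S A lam) star (\<lambda>s. ls (emb s)) (eps \<one>\<^bsub>G\<^esub>)"
  unfolding equivariant_hom_def
  by (simp add: star.inj_hom eps_transition star_actionD[OF assms] emb_closed)

end

section \<open>Equivariant homomorphisms and the maps they induce\<close>

locale fraction_action_hom =
  X: fraction_action S G emb A lam + Y: fraction_action S G emb B mu
  for S :: "('s, 'm) monoid_scheme" and G :: "('g, 'n) monoid_scheme" and emb :: "'s \<Rightarrow> 'g"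
    and A :: "('x, 'k) monoid_scheme" and lam :: "'s \<Rightarrow> 'x \<Rightarrow> 'x"
    and B :: "('y, 'l) monoid_scheme" and mu :: "'s \<Rightarrow> 'y \<Rightarrow> 'y" +
  fixes \<phi> :: "'x \<Rightarrow> 'y"
  assumes equivariant: "equivariant_hom S A lam B mu \<phi>"
begin

lemma \<phi>_hom: "\<phi> \<in> hom A B"
  using equivariant unfolding equivariant_hom_def by blast

lemma \<phi>_closed: "x \<in> carrier A \<Longrightarrow> \<phi> x \<in> carrier B"
  using \<phi>_hom by (rule hom_in_carrier)

lemma \<phi>_lam: "s \<in> carrier S \<Longrightarrow> x \<in> carrier A \<Longrightarrow> \<phi> (lam s x) = mu s (\<phi> x)"
  using equivariant unfolding equivariant_hom_def by blast

text \<open>If \<open>lam s\<close> identifies \<open>x\<close> and \<open>y\<close>, equivariance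
  shows that \<open>mu s\<close> identifies their images, so \<open>\<phi>\<close> respects
  cosets.\<close>

lemma bar_proj: "x \<in> carrier A \<Longrightarrow> bar_map S B mu \<phi> (X.proj x) = Y.proj (\<phi> x)"
proof (rule X.bar_map_proj)
  fix y assume x: "x \<in> carrier A" and y: "y \<in> carrier A" and "X.proj x = X.proj y"
  then obtain s where "s \<in> carrier S" "lam s x = lam s y"
    using X.proj_eq_iff[OF x y] by blast
  then show "Y.proj (\<phi> x) = Y.proj (\<phi> y)"
    unfolding Y.proj_eq_iff[OF \<phi>_closed[OF x] \<phi>_closed[OF y]]
    using x y by (intro bexI[of _ s]) (simp_all flip: \<phi>_lam)
qed

lemma bar_hom: "bar_map S B mu \<phi> \<in> hom X.bar Y.bar"
  by (rule homI)
    (auto simp: X.carrier_bar Y.carrier_bar bar_proj \<phi>_closed X.proj_mult Y.proj_mult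
      hom_mult[OF \<phi>_hom])

lemma bar_closed: "x \<in> carrier X.bar \<Longrightarrow> bar_map S B mu \<phi> x \<in> carrier Y.bar"
  using bar_hom by (rule hom_in_carrier)

lemma bar_equivariant:
  "s \<in> carrier S \<Longrightarrow> x \<in> carrier X.bar \<Longrightarrow>
    bar_map S B mu \<phi> (bar_action S A lam s x) = bar_action S B mu s (bar_map S B mu \<phi> x)"
  by (auto simp: X.carrier_bar X.bar_action_proj Y.bar_action_proj bar_proj \<phi>_closed \<phi>_lam
      X.lam_closed)

text \<open>If the images of two cosets agree, some \<open>mu s\<close> identifies
  \<open>\<phi> x\<close> and \<open>\<phi> y\<close>. Equivariance moves \<open>s\<close> inside
  \<open>\<phi>\<close>, whose injectivity then gives \<open>lam s x = lam s y\<close>.\<close>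

lemma bar_inj:
  assumes "inj_on \<phi> (carrier A)"
  shows "inj_on (bar_map S B mu \<phi>) (carrier X.bar)"
proof (rule inj_onI)
  fix C D assume "C \<in> carrier X.bar" "D \<in> carrier X.bar"
    and eq: "bar_map S B mu \<phi> C = bar_map S B mu \<phi> D"
  then obtain x y where xy: "x \<in> carrier A" "y \<in> carrier A" "C = X.proj x" "D = X.proj y"
    unfolding X.carrier_bar by blast
  then have "Y.proj (\<phi> x) = Y.proj (\<phi> y)"
    using eq by (simp add: bar_proj)
  then obtain s where s: "s \<in> carrier S" "mu s (\<phi> x) = mu s (\<phi> y)"
    using Y.proj_eq_iff[OF \<phi>_closed[OF xy(1)] \<phi>_closed[OF xy(2)]] by blast
  then have "lam s x = lam s y"
    using assms xy by (simp add: \<phi>_lam[symmetric] X.lam_closed inj_on_eq_iff)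
  then show "C = D"
    using s(1) unfolding xy(3,4) X.proj_eq_iff[OF xy(1,2)] by blast
qed

lemma bar_surj:
  assumes "\<phi> ` carrier A = carrier B"
  shows "bar_map S B mu \<phi> ` carrier X.bar = carrier Y.bar"
proof -
  have "bar_map S B mu \<phi> ` carrier X.bar = Y.proj ` \<phi> ` carrier A"
    unfolding X.carrier_bar image_image by (rule image_cong) (simp_all add: bar_proj)
  then show ?thesis
    by (simp add: assms Y.carrier_bar)
qed

text \<open>The universal property applies because the map induced on the quotients commutes with
  the induced actions, and these are the transition maps.\<close>

lemma ex1_star_hom:
  "\<exists>!p. p \<in> extensional (carrier X.star) \<and> star_hom S G emb A lam B mu \<phi> p"
proof (rule ex_ex1I)
  show "\<exists>p. p \<in> extensional (carrier X.star) \<and> star_hom S G emb A lam B mu \<phi> p"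
  proof (rule X.star.universal_property[of "\<lambda>g x. Y.eps g (bar_map S B mu \<phi> x)" Y.star])
    show "(\<lambda>x. Y.eps g (bar_map S B mu \<phi> x)) \<in> hom X.bar Y.star" if "g \<in> carrier G" for g
      using hom_compose[OF bar_hom Y.star.inj_hom[OF that]] by (simp add: comp_def)
    show "Y.eps h (bar_map S B mu \<phi> (star_transition S G emb A lam g h x)) =
        Y.eps g (bar_map S B mu \<phi> x)"
      if "(g, h) \<in> frac_order S G emb" "x \<in> carrier X.bar" for g h x
      using that
      by (auto elim!: X.frac_orderE simp: X.star_transition_eq bar_equivariant Y.eps_transition
          bar_closed)
  qed (auto simp: star_hom_def)
  fix p q
  assume "p \<in> extensional (carrier X.star) \<and> star_hom S G emb A lam B mu \<phi> p"
    and "q \<in> extensional (carrier X.star) \<and> star_hom S G emb A lam B mu \<phi> q"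
  then show "p = q"
    unfolding star_hom_def by (intro X.star.extensional_eqI) auto
qed

section \<open>Equivariance, injectivity and surjectivity of the induced map\<close>

context
  fixes p assumes p: "star_hom S G emb A lam B mu \<phi> p"
begin

lemma star_hom_eps:
  "g \<in> carrier G \<Longrightarrow> x \<in> carrier X.bar \<Longrightarrow> p (X.eps g x) = Y.eps g (bar_map S B mu \<phi> x)"
  using p unfolding star_hom_def by blast

text \<open>On an element \<open>eps h x\<close> both sides reduce to the canonical map with index
  \<open>g h\<close>, applied to the image of \<open>x\<close>.\<close>

lemma star_hom_equivariant:
  assumes "star_action S G emb A lam ls" "star_action S G emb B mu ms"
  shows "equivariant_hom G X.star ls Y.star ms p"
  unfolding equivariant_hom_def
proof (intro conjI ballI)
  show "p \<in> hom X.star Y.star"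
    using p unfolding star_hom_def by blast
  fix g P assume "g \<in> carrier G" "P \<in> carrier X.star"
  then show "p (ls g P) = ms g (p P)"
    by (auto elim!: X.star.limE simp: X.star_actionD[OF assms(1)] Y.star_actionD[OF assms(2)]
        star_hom_eps bar_closed)
qed

text \<open>Once both elements are represented at one index \<open>g\<close>, the claim reduces to
  injectivity of \<open>Y.eps g\<close> and of the map between the quotients.\<close>

lemma star_hom_inj:
  assumes "inj_on \<phi> (carrier A)"
  shows "inj_on p (carrier X.star)"
proof (rule inj_onI)
  fix P Q assume PQ: "P \<in> carrier X.star" "Q \<in> carrier X.star" and eq: "p P = p Q"
  obtain g x y where g: "g \<in> carrier G" and xy: "x \<in> carrier X.bar" "y \<in> carrier X.bar"
    "P = X.eps g x" "Q = X.eps g y"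
    using PQ by (rule X.star.common_index)
  then have "bar_map S B mu \<phi> x = bar_map S B mu \<phi> y"
    using eq Y.eps_inj[OF g] by (simp add: star_hom_eps bar_closed inj_on_eq_iff)
  then show "P = Q"
    using bar_inj[OF assms] xy by (simp add: inj_on_eq_iff)
qed

text \<open>Both limits are unions of images of canonical maps, so surjectivity can be checked index
  by index, where it is \<open>bar_surj\<close>.\<close>

lemma star_hom_surj:
  assumes "\<phi> ` carrier A = carrier B"
  shows "p ` carrier X.star = carrier Y.star"
proof -
  have "p ` carrier X.star =
      (\<Union>g\<in>carrier G. Y.eps g ` bar_map S B mu \<phi> ` carrier X.bar)"
    unfolding X.star.carrier_lim by (auto simp: star_hom_eps image_UN image_image)
  then show ?thesis
    by (simp add: bar_surj[OF assms] Y.star.carrier_lim)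
qed

end

end

theorem lemma2p6:
  fixes S :: "('s, 'm) monoid_scheme"
    and G :: "('g, 'n) monoid_scheme"
    and emb :: "'s \<Rightarrow> 'g"
    and A :: "('x, 'k) monoid_scheme"
    and lam :: "'s \<Rightarrow> 'x \<Rightarrow> 'x"
  assumes "monoid_cancel S"
    and "right_amenable TYPE('i) S"
    and "left_fraction_group S G emb"
    and "comm_group A"
    and "left_action S A lam"
  shows
    "((\<forall>g\<in>carrier G. inj_on (star_inj S G emb A lam g) (carrier (bar_group S A lam))) \<and>
      carrier (star_group S G emb A lam) =
        (\<Union>g\<in>carrier G. star_inj S G emb A lam g ` carrier (bar_group S A lam)))
     \<and>
     (\<exists>!ls. ls \<in> carrier G \<rightarrow>\<^sub>E
               (carrier (star_group S G emb A lam) \<rightarrow>\<^sub>E carrier (star_group S G emb A lam)) \<and>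
            star_action S G emb A lam ls)
     \<and>
     (\<forall>ls. star_action S G emb A lam ls \<longrightarrow>
        equivariant_hom S (bar_group S A lam) (bar_action S A lam)
          (star_group S G emb A lam) (\<lambda>s. ls (emb s)) (star_inj S G emb A lam \<one>\<^bsub>G\<^esub>))
     \<and>
     (\<forall>(B :: ('y, 'l) monoid_scheme) mu \<phi>.
        comm_group B \<and> left_action S B mu \<and> equivariant_hom S A lam B mu \<phi> \<longrightarrow>
        (\<exists>!p. p \<in> extensional (carrier (star_group S G emb A lam)) \<and>
              star_hom S G emb A lam B mu \<phi> p) \<and>
        (\<forall>p. star_hom S G emb A lam B mu \<phi> p \<longrightarrow>
           (\<forall>ls ms. star_action S G emb A lam ls \<and> star_action S G emb B mu ms \<longrightarrow>
              equivariant_hom G (star_group S G emb A lam) ls (star_group S G emb B mu) ms p) \<and>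
           (inj_on \<phi> (carrier A) \<longrightarrow> inj_on p (carrier (star_group S G emb A lam))) \<and>
           (\<phi> ` carrier A = carrier B \<longrightarrow>
              p ` carrier (star_group S G emb A lam) = carrier (star_group S G emb B mu))))"
proof -
  have left_fractions: "left_fractions S G emb"
    using assms(1,3) by (simp add: left_fractions_def left_fractions_axioms_def
        left_fraction_group_def)
  \<comment> \<open>Stated over fresh type variables, since it is applied both to \<open>A\<close>
    and to \<open>B\<close>, whose element types differ.\<close>
  have action: "fraction_action S G emb D nu" if "left_action S D nu"
    for D :: "('z, 'q) monoid_scheme" and nu
    using that left_fractions
    by (simp add: fraction_action_def fraction_action_axioms_def left_action_def)
  interpret X: fraction_action S G emb A lam
    using assms(5) by (rule action)
  have hom: "fraction_action_hom S G emb A lam B mu \<phi>"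
    if "left_action S B mu" "equivariant_hom S A lam B mu \<phi>"
    for B :: "('y, 'l) monoid_scheme" and mu \<phi>
    using that action X.fraction_action_axioms
    by (simp add: fraction_action_hom_def fraction_action_hom_axioms_def)
  show ?thesis
  \<comment> \<open>Cases 1 and 2 are injectivity and the union, 3 is the unique action, 4 the
    equivariance of the canonical map at the unit, and 5 to 8 concern the induced
    homomorphism.\<close>
  proof (intro conjI allI impI ballI, goal_cases)
    case 1 then show ?case by (rule X.eps_inj)
  next
    case 2 show ?case by (rule X.star.carrier_lim)
  next
    case 3 show ?case by (rule X.ex1_star_action)
  next
    case 4 then show ?case by (rule X.eps_one_equivariant)
  next
    case (5 B mu \<phi>)
    then interpret fraction_action_hom S G emb A lam B mu \<phi>
      by (intro hom) auto
    show ?case by (rule ex1_star_hom)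
  next
    case (6 B mu \<phi> p ls ms)
    then interpret fraction_action_hom S G emb A lam B mu \<phi>
      by (intro hom) auto
    show ?case using 6 by (intro star_hom_equivariant) auto
  next
    case (7 B mu \<phi> p)
    then interpret fraction_action_hom S G emb A lam B mu \<phi>
      by (intro hom) auto
    show ?case using 7 by (intro star_hom_inj) auto
  next
    case (8 B mu \<phi> p)
    then interpret fraction_action_hom S G emb A lam B mu \<phi>
      by (intro hom) auto
    show ?case using 8 by (intro star_hom_surj) auto
  qed
qed

end
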